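(* Let $S$ be a finite set, $M=(m_{s,t})_{s,t\in S}$ a Coxeter matrix over $S$, and $A_S$ the associated Artin group. Then $A_S$ is parabolic-retractable if and only if, for every triple $a,b,c\in S$ of pairwise distinct elements, the standard parabolic subgroup $A_{\{a,b,c\}}$ admits a retraction onto $A_{\{b,c\}}$.
   Context: A Coxeter matrix over a finite set $S$ is a matrix $M=(m_{s,t})_{s,t\in S}$ with entries in $\mathbb{N}\cup\{\infty\}$, $m_{s,s}=1$, and $m_{s,t}=m_{t,s}\ge 2$ for $s\neq t$. Write $\Pi(s,t,m)$ for the alternating word $sts\cdots$ of length $m$. The Artin group of $M$ is $A_S=\langle S\mid \Pi(s,t,m_{s,t})=\Pi(t,s,m_{s,t})$ for $s\neq t$, $m_{s,t}\neq\infty\rangle$. For $X\subseteq S$, the standard parabolic subgroup $A_X$ is the subgroup generated by $X$ (it is the Artin group of the submatrix of $M$ indexed by $X$). A retraction of a group $G$ onto a subgroup $H$ is a homomorphism $\varphi:G\to H$ with $\varphi|_H=\mathrm{id}_H$. $A_S$ is called parabolic-retractable if it admits a retraction onto $A_X$ for every $X\subseteq S$. *)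

theory Defs
  imports "HOL-Library.Extended_Nat" "HOL-Algebra.Generated_Groups"
begin

definition coxeter_matrix :: "'a set \<Rightarrow> ('a \<Rightarrow> 'a \<Rightarrow> enat) \<Rightarrow> bool" where
  "coxeter_matrix S m \<longleftrightarrow>
     (\<forall>s\<in>S. m s s = 1) \<and>
     (\<forall>s\<in>S. \<forall>t\<in>S. s \<noteq> t \<longrightarrow> m s t = m t s \<and> m s t \<ge> 2)"

definition alt_word :: "'a \<Rightarrow> 'a \<Rightarrow> nat \<Rightarrow> 'a list" where
  "alt_word s t n = map (\<lambda>i. if even i then s else t) [0..<n]"

text \<open>Words in the free group on S: letters (s, True) = s, (s, False) = s inverse.
  The Artin congruence: equivalence generated by free reduction and braid relations,
  closed under concatenation contexts.\<close>
inductive artin_eq :: "'a set \<Rightarrow> ('a \<Rightarrow> 'a \<Rightarrow> enat) \<Rightarrow> ('a \<times> bool) list \<Rightarrow> ('a \<times> bool) list \<Rightarrow> bool"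
  for S m where
  refl: "w \<in> lists (S \<times> UNIV) \<Longrightarrow> artin_eq S m w w"
| sym: "artin_eq S m u v \<Longrightarrow> artin_eq S m v u"
| trans: "artin_eq S m u v \<Longrightarrow> artin_eq S m v w \<Longrightarrow> artin_eq S m u w"
| free: "u \<in> lists (S \<times> UNIV) \<Longrightarrow> v \<in> lists (S \<times> UNIV) \<Longrightarrow> s \<in> S \<Longrightarrow>
         artin_eq S m (u @ [(s, b), (s, \<not> b)] @ v) (u @ v)"
| braid: "u \<in> lists (S \<times> UNIV) \<Longrightarrow> v \<in> lists (S \<times> UNIV) \<Longrightarrow> s \<in> S \<Longrightarrow> t \<in> S \<Longrightarrow>
          s \<noteq> t \<Longrightarrow> m s t = enat k \<Longrightarrow>
          artin_eq S m (u @ map (\<lambda>x. (x, True)) (alt_word s t k) @ v)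
                       (u @ map (\<lambda>x. (x, True)) (alt_word t s k) @ v)"

definition artin_class :: "'a set \<Rightarrow> ('a \<Rightarrow> 'a \<Rightarrow> enat) \<Rightarrow> ('a \<times> bool) list \<Rightarrow> ('a \<times> bool) list set" where
  "artin_class S m w = {w'. artin_eq S m w w'}"

definition artin_group :: "'a set \<Rightarrow> ('a \<Rightarrow> 'a \<Rightarrow> enat) \<Rightarrow> ('a \<times> bool) list set monoid" where
  "artin_group S m =
     \<lparr> carrier = artin_class S m ` lists (S \<times> UNIV),
       mult = (\<lambda>A B. {w. \<exists>u\<in>A. \<exists>v\<in>B. artin_eq S m (u @ v) w}),
       one = artin_class S m [] \<rparr>"

definition artin_gen :: "'a set \<Rightarrow> ('a \<Rightarrow> 'a \<Rightarrow> enat) \<Rightarrow> 'a \<Rightarrow> ('a \<times> bool) list set" where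
  "artin_gen S m s = artin_class S m [(s, True)]"

definition parabolic :: "'a set \<Rightarrow> ('a \<Rightarrow> 'a \<Rightarrow> enat) \<Rightarrow> 'a set \<Rightarrow> ('a \<times> bool) list set set" where
  "parabolic S m X = generate (artin_group S m) (artin_gen S m ` X)"

definition has_retraction :: "('g, 'b) monoid_scheme \<Rightarrow> 'g set \<Rightarrow> bool" where
  "has_retraction G H \<longleftrightarrow>
     (\<exists>\<phi>. \<phi> \<in> hom G (G\<lparr>carrier := H\<rparr>) \<and> (\<forall>h\<in>H. \<phi> h = h))"

definition parabolic_retractable :: "'a set \<Rightarrow> ('a \<Rightarrow> 'a \<Rightarrow> enat) \<Rightarrow> bool" where
  "parabolic_retractable S m \<longleftrightarrow>
     (\<forall>X\<subseteq>S. has_retraction (artin_group S m) (parabolic S m X))"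

end

theory Submission
  imports Defs Complex_Main
begin

text \<open>
  Suppose \<open>A\<^bsub>{a,b,c}\<^esub>\<close> retracts onto \<open>A\<^bsub>{b,c}\<^esub>\<close>, let \<open>w\<close> be the image of \<open>a\<close>, and put
  \<open>p = m a b\<close>, \<open>q = m a c\<close>, \<open>r = m b c\<close> with \<open>p\<close> odd and \<open>q\<close> finite. The one-parameter deformation of
  the geometric representation of the Coxeter group is a representation of all of \<open>A\<^sub>S\<close>. At the
  parameter \<open>\<eta>\<close>, a primitive \<open>r\<close>-th root of unity, the two coordinates belonging to \<open>b\<close> and \<open>c\<close> carry
  an action of \<open>A\<^bsub>{b,c}\<^esub>\<close> by affine maps of an invariant line, where \<open>b\<close> and \<open>c\<close> have slope \<open>-\<eta>\<close> and
  fixed points \<open>0\<close> and \<open>1\<close>. Since \<open>p\<close> is odd, \<open>w\<close> has slope \<open>-\<eta>\<close> too. Two affine maps of slope \<open>-\<eta>\<close>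
  satisfy a braid relation of length \<open>n\<close> only if they are equal or \<open>\<eta>\<^sup>n = 1\<close>; as \<open>w\<close> cannot fix both
  \<open>0\<close> and \<open>1\<close>, \<open>r\<close> divides \<open>p\<close> or \<open>q\<close>. For \<open>r = 2\<close> the affine action is trivial and the parameter \<open>1\<close>
  is used instead.

  These divisibility conditions imply that having an odd label is an equivalence relation, that the
  label between two classes depends only on the classes, and that inside a class the labels form an
  ultrametric for divisibility. A retraction onto \<open>A\<^sub>X\<close> then sends a generator to a nearest element
  of \<open>X\<close> in its class, or to \<open>1\<close> if its class does not meet \<open>X\<close>.
\<close>

section \<open>Alternating products\<close>

fun alt_prod :: "('g, 'b) monoid_scheme \<Rightarrow> 'g \<Rightarrow> 'g \<Rightarrow> nat \<Rightarrow> 'g" where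
  "alt_prod G x y 0 = \<one>\<^bsub>G\<^esub>"
| "alt_prod G x y (Suc n) = x \<otimes>\<^bsub>G\<^esub> alt_prod G y x n"

lemma alt_prod_carrier_update [simp]:
  "alt_prod (G\<lparr>carrier := H\<rparr>) x y n = alt_prod G x y n"
  by (induction n arbitrary: x y) auto

context monoid
begin

lemma alt_prod_closed [simp]:
  "x \<in> carrier G \<Longrightarrow> y \<in> carrier G \<Longrightarrow> alt_prod G x y n \<in> carrier G"
  by (induction n arbitrary: x y) auto

lemma alt_prod_add:
  assumes "x \<in> carrier G" "y \<in> carrier G"
  shows "alt_prod G x y (i + j) =
    alt_prod G x y i \<otimes> (if even i then alt_prod G x y j else alt_prod G y x j)"
  using assms by (induction i arbitrary: x y) (auto simp: m_assoc)

text \<open>A word of length \<open>j * d\<close> splits into \<open>d\<close> blocks of length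
  \<open>j\<close>, and the hypothesis switches the leading letter of each block. This is why
  divisibility of labels suffices to carry over a braid relation.\<close>

lemma alt_prod_swap_dvd:
  assumes "x \<in> carrier G" "y \<in> carrier G"
    and eq: "alt_prod G x y j = alt_prod G y x j" and "j dvd k"
  shows "alt_prod G x y k = alt_prod G y x k"
proof -
  have "alt_prod G x y (j * d) = alt_prod G y x (j * d)" for d
    by (induction d) (simp_all add: alt_prod_add assms)
  with \<open>j dvd k\<close> show ?thesis by (auto elim: dvdE)
qed

text \<open>Both sides are the power of \<open>y\<close> with exponent \<open>n div 2\<close>. It
  serves when one of two braided generators is sent to the identity.\<close>

lemma alt_prod_one_even:
  assumes "y \<in> carrier G" "even n"
  shows "alt_prod G \<one> y n = alt_prod G y \<one> n"
proof -
  have "alt_prod G \<one> y (2 * k) = alt_prod G y \<one> (2 * k)" for k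
    using assms(1) by (induction k) auto
  with \<open>even n\<close> show ?thesis by (auto elim: evenE)
qed

end

lemma hom_alt_prod:
  assumes "monoid G" "h \<in> hom G H" "h \<one>\<^bsub>G\<^esub> = \<one>\<^bsub>H\<^esub>" "x \<in> carrier G" "y \<in> carrier G"
  shows "h (alt_prod G x y n) = alt_prod H (h x) (h y) n"
  using assms(4,5)
proof (induction n arbitrary: x y)
  case (Suc n)
  then show ?case
    using monoid.alt_prod_closed[OF assms(1)] by (simp add: hom_mult[OF assms(2)])
qed (simp add: assms)

section \<open>Artin groups and their universal property\<close>

declare in_listsD [rule del] in_listsI [rule del]

definition word_eval :: "('g, 'b) monoid_scheme \<Rightarrow> ('l \<Rightarrow> 'g) \<Rightarrow> 'l list \<Rightarrow> 'g" where
  "word_eval G g w = foldr (\<lambda>l p. g l \<otimes>\<^bsub>G\<^esub> p) w \<one>\<^bsub>G\<^esub>"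

lemma word_eval_simps [simp]:
  "word_eval G g [] = \<one>\<^bsub>G\<^esub>" "word_eval G g (l # w) = g l \<otimes>\<^bsub>G\<^esub> word_eval G g w"
  by (simp_all add: word_eval_def)

lemma (in monoid) word_eval_closed:
  "w \<in> lists L \<Longrightarrow> (\<And>l. l \<in> L \<Longrightarrow> g l \<in> carrier G) \<Longrightarrow> word_eval G g w \<in> carrier G"
  by (induction w) auto

lemma (in monoid) word_eval_append:
  assumes "u \<in> lists L" "v \<in> lists L" "\<And>l. l \<in> L \<Longrightarrow> g l \<in> carrier G"
  shows "word_eval G g (u @ v) = word_eval G g u \<otimes> word_eval G g v"
  using assms(1)
  by (induction u) (auto simp: m_assoc assms(3) word_eval_closed[OF _ assms(3)] word_eval_closed[OF assms(2,3)])

lemma alt_word_0 [simp]: "alt_word s t 0 = []"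
  by (simp add: alt_word_def)

lemma alt_word_Suc [simp]: "alt_word s t (Suc n) = s # alt_word t s n"
  unfolding alt_word_def upt_conv_Cons[OF zero_less_Suc] map_Suc_upt[symmetric] by simp

lemma alt_word_lists:
  "s \<in> S \<Longrightarrow> t \<in> S \<Longrightarrow> map (\<lambda>x. (x, True)) (alt_word s t n) \<in> lists (S \<times> UNIV)"
  by (induction n arbitrary: s t) auto

lemma word_eval_alt_word:
  "word_eval G g (map (\<lambda>x. (x, True)) (alt_word s t n)) = alt_prod G (g (s, True)) (g (t, True)) n"
  by (induction n arbitrary: s t) auto

lemma artin_eq_lists:
  "artin_eq S m u v \<Longrightarrow> u \<in> lists (S \<times> UNIV) \<and> v \<in> lists (S \<times> UNIV)"
proof (induction rule: artin_eq.induct)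
  case (braid u v s t k)
  then show ?case using alt_word_lists[of s S t k] alt_word_lists[of t S s k] by simp
qed auto

text \<open>The words \<open>u\<close> and \<open>v\<close> in the rules \<open>free\<close> and
  \<open>braid\<close> absorb \<open>x\<close> and \<open>y\<close>, so the relation is a congruence
  although no rule says so.\<close>

lemma artin_eq_context:
  "artin_eq S m u v \<Longrightarrow> x \<in> lists (S \<times> UNIV) \<Longrightarrow> y \<in> lists (S \<times> UNIV) \<Longrightarrow>
    artin_eq S m (x @ u @ y) (x @ v @ y)"
proof (induction rule: artin_eq.induct)
  case (refl w)
  then show ?case by (intro artin_eq.refl) auto
next
  case (sym u v)
  then show ?case by (blast intro: artin_eq.sym)
next
  case (trans u v w)
  then show ?case by (blast intro: artin_eq.trans)
next
  case (free u v s b)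
  then show ?case using artin_eq.free[of "x @ u" S "v @ y" s m b] by simp
next
  case (braid u v s t k)
  then show ?case using artin_eq.braid[of "x @ u" S "v @ y" s t m k] by simp
qed

lemma artin_eq_append:
  assumes "artin_eq S m u u'" "artin_eq S m v v'"
  shows "artin_eq S m (u @ v) (u' @ v')"
proof (rule artin_eq.trans)
  show "artin_eq S m (u @ v) (u' @ v)"
    using artin_eq_context[OF assms(1), of "[]" v] artin_eq_lists[OF assms(2)] by simp
  show "artin_eq S m (u' @ v) (u' @ v')"
    using artin_eq_context[OF assms(2), of u' "[]"] artin_eq_lists[OF assms(1)] by simp
qed

lemma artin_class_eq:
  assumes "artin_eq S m u v"
  shows "artin_class S m u = artin_class S m v"
  unfolding artin_class_def
  using artin_eq.trans[OF assms] artin_eq.trans[OF artin_eq.sym[OF assms]] by blast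

lemma artin_class_self: "w \<in> lists (S \<times> UNIV) \<Longrightarrow> w \<in> artin_class S m w"
  unfolding artin_class_def by (simp add: artin_eq.refl)

lemma artin_carrier: "carrier (artin_group S m) = artin_class S m ` lists (S \<times> UNIV)"
  by (simp add: artin_group_def)

lemma artin_one: "\<one>\<^bsub>artin_group S m\<^esub> = artin_class S m []"
  by (simp add: artin_group_def)

lemma artin_class_mult:
  assumes "u \<in> lists (S \<times> UNIV)" "v \<in> lists (S \<times> UNIV)"
  shows "artin_class S m u \<otimes>\<^bsub>artin_group S m\<^esub> artin_class S m v = artin_class S m (u @ v)"
proof -
  have "artin_eq S m (u @ v) w" if "artin_eq S m u u'" "artin_eq S m v v'" "artin_eq S m (u' @ v') w"
    for u' v' w
    using artin_eq_append[OF that(1,2)] that(3) by (rule artin_eq.trans)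
  moreover have "artin_eq S m u u" "artin_eq S m v v" using assms by (auto intro: artin_eq.refl)
  ultimately show ?thesis unfolding artin_group_def artin_class_def by (simp, blast)
qed

lemma artin_class_inverse:
  assumes "s \<in> S"
  shows "artin_class S m [(s, b), (s, \<not> b)] = artin_class S m []"
  using artin_eq.free[of "[]" S "[]" s m b] assms by (intro artin_class_eq) simp

lemma artin_group_group: "group (artin_group S m)"
proof (rule groupI)
  fix x y assume "x \<in> carrier (artin_group S m)" "y \<in> carrier (artin_group S m)"
  then show "x \<otimes>\<^bsub>artin_group S m\<^esub> y \<in> carrier (artin_group S m)"
    by (auto simp: artin_carrier artin_class_mult)
next
  fix x y z
  assume "x \<in> carrier (artin_group S m)" "y \<in> carrier (artin_group S m)" "z \<in> carrier (artin_group S m)"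
  then show "x \<otimes>\<^bsub>artin_group S m\<^esub> y \<otimes>\<^bsub>artin_group S m\<^esub> z =
      x \<otimes>\<^bsub>artin_group S m\<^esub> (y \<otimes>\<^bsub>artin_group S m\<^esub> z)"
    by (auto simp: artin_carrier artin_class_mult)
next
  fix x assume "x \<in> carrier (artin_group S m)"
  then obtain w where w: "w \<in> lists (S \<times> UNIV)" and x: "x = artin_class S m w"
    by (auto simp: artin_carrier)
  \<comment> \<open>The inverse word is built letter by letter: a leading letter of \<open>w\<close>
    puts its flipped letter at the end of \<open>w'\<close>.\<close>
  from w have "\<exists>w'\<in>lists (S \<times> UNIV). artin_eq S m (w' @ w) []"
  proof (induction w)
    case Nil
    then show ?case by (auto intro: artin_eq.refl)
  next
    case (Cons l w)
    then obtain w' where w': "w' \<in> lists (S \<times> UNIV)" "artin_eq S m (w' @ w) []" by auto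
    obtain s b where l: "l = (s, b)" by (cases l)
    with Cons have "artin_eq S m (w' @ [(s, \<not> b), (s, \<not> \<not> b)] @ w) (w' @ w)"
      using w' by (intro artin_eq.free) auto
    then have "artin_eq S m ((w' @ [(s, \<not> b)]) @ l # w) []"
      using artin_eq.trans[OF _ w'(2)] l by simp
    moreover have "w' @ [(s, \<not> b)] \<in> lists (S \<times> UNIV)" using w' Cons l by auto
    ultimately show ?case by blast
  qed
  then obtain w' where "w' \<in> lists (S \<times> UNIV)" "artin_eq S m (w' @ w) []" by blast
  then have "artin_class S m w' \<in> carrier (artin_group S m)"
    "artin_class S m w' \<otimes>\<^bsub>artin_group S m\<^esub> x = \<one>\<^bsub>artin_group S m\<^esub>"
    using w artin_class_eq[of S m "w' @ w" "[]"]
    by (simp_all add: artin_carrier artin_one artin_class_mult x)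
  then show "\<exists>y\<in>carrier (artin_group S m). y \<otimes>\<^bsub>artin_group S m\<^esub> x = \<one>\<^bsub>artin_group S m\<^esub>"
    by blast
qed (auto simp: artin_carrier artin_one artin_class_mult)

lemma artin_group_monoid: "monoid (artin_group S m)"
  using artin_group_group by (rule group.is_monoid)

lemma artin_gen_closed: "s \<in> S \<Longrightarrow> artin_gen S m s \<in> carrier (artin_group S m)"
  by (auto simp: artin_gen_def artin_carrier)

lemma artin_gen_image_closed: "X \<subseteq> S \<Longrightarrow> artin_gen S m ` X \<subseteq> carrier (artin_group S m)"
  by (auto intro: artin_gen_closed)

lemma artin_inv_gen:
  assumes "s \<in> S"
  shows "inv\<^bsub>artin_group S m\<^esub> artin_gen S m s = artin_class S m [(s, False)]"
proof (rule group.inv_equality[OF artin_group_group])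
  show "artin_class S m [(s, False)] \<otimes>\<^bsub>artin_group S m\<^esub> artin_gen S m s = \<one>\<^bsub>artin_group S m\<^esub>"
    unfolding artin_gen_def artin_one
    using assms artin_class_inverse[of s S m False] by (subst artin_class_mult) auto
  show "artin_gen S m s \<in> carrier (artin_group S m)" using assms by (rule artin_gen_closed)
  show "artin_class S m [(s, False)] \<in> carrier (artin_group S m)"
    unfolding artin_carrier using assms by simp
qed

lemma artin_class_word_eval:
  "w \<in> lists (S \<times> UNIV) \<Longrightarrow>
    word_eval (artin_group S m) (\<lambda>l. artin_class S m [l]) w = artin_class S m w"
  by (induction w) (auto simp: artin_one artin_class_mult)

lemma artin_gen_braid:
  assumes "s \<in> S" "t \<in> S" "s \<noteq> t" "m s t = enat k"
  shows "alt_prod (artin_group S m) (artin_gen S m s) (artin_gen S m t) k =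
    alt_prod (artin_group S m) (artin_gen S m t) (artin_gen S m s) k"
proof -
  let ?w = "\<lambda>s t. map (\<lambda>x. (x, True)) (alt_word s t k)"
  have "artin_eq S m (?w s t) (?w t s)"
    using artin_eq.braid[of "[]" S "[]" s t m k] assms by simp
  then have "artin_class S m (?w s t) = artin_class S m (?w t s)" by (rule artin_class_eq)
  then show ?thesis
    unfolding artin_class_word_eval[OF alt_word_lists[OF assms(1,2)], symmetric]
      artin_class_word_eval[OF alt_word_lists[OF assms(2,1)], symmetric]
    by (simp add: word_eval_alt_word artin_gen_def)
qed

lemma parabolic_subgroup:
  "X \<subseteq> S \<Longrightarrow> subgroup (parabolic S m X) (artin_group S m)"
  unfolding parabolic_def
  by (intro group.generate_is_subgroup artin_group_group artin_gen_image_closed)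

lemma artin_gen_in_parabolic: "s \<in> X \<Longrightarrow> artin_gen S m s \<in> parabolic S m X"
  unfolding parabolic_def by (auto intro: generate.incl)

section \<open>Homomorphisms from an Artin group to a monoid\<close>

definition artin_lift ::
  "('g, 'b) monoid_scheme \<Rightarrow> ('a \<times> bool \<Rightarrow> 'g) \<Rightarrow> ('a \<times> bool) list set \<Rightarrow> 'g" where
  "artin_lift G g A = word_eval G g (SOME w. w \<in> A)"

text \<open>The target is only a monoid: inverse letters carry values of their own, and
  \<open>letter_inverse\<close> for both values of \<open>b\<close> makes them two-sided inverses.
  Maps into a monoid of self-maps then need no separate proof of bijectivity.\<close>

locale artin_assignment = monoid G for G :: "('g, 'b) monoid_scheme" (structure) +
  fixes S :: "'a set" and m :: "'a \<Rightarrow> 'a \<Rightarrow> enat" and g :: "'a \<times> bool \<Rightarrow> 'g"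
  assumes letter_closed: "\<And>s b. s \<in> S \<Longrightarrow> g (s, b) \<in> carrier G"
    and letter_inverse: "\<And>s b. s \<in> S \<Longrightarrow> g (s, b) \<otimes> g (s, \<not> b) = \<one>"
    and letter_braid: "\<And>s t k. s \<in> S \<Longrightarrow> t \<in> S \<Longrightarrow> s \<noteq> t \<Longrightarrow> m s t = enat k \<Longrightarrow>
      alt_prod G (g (s, True)) (g (t, True)) k = alt_prod G (g (t, True)) (g (s, True)) k"
begin

lemma letters_closed: "l \<in> S \<times> UNIV \<Longrightarrow> g l \<in> carrier G"
  using letter_closed by auto

lemmas eval_closed = word_eval_closed[OF _ letters_closed]
lemmas eval_append = word_eval_append[OF _ _ letters_closed]

lemma word_eval_artin_eq: "artin_eq S m u v \<Longrightarrow> word_eval G g u = word_eval G g v"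
proof (induction rule: artin_eq.induct)
  case (free u v s b)
  then have "word_eval G g ([(s, b), (s, \<not> b)] @ v) = word_eval G g v"
    by (simp add: m_assoc[symmetric] letter_closed letter_inverse eval_closed)
  moreover have "[(s, b), (s, \<not> b)] @ v \<in> lists (S \<times> UNIV)" using free by auto
  ultimately show ?case using free by (simp only: eval_append)
next
  case (braid u v s t k)
  then show ?case
    using letter_braid[of s t k] alt_word_lists[of s S t k] alt_word_lists[of t S s k]
    by (simp add: eval_append word_eval_alt_word)
qed auto

lemma lift_class:
  assumes "w \<in> lists (S \<times> UNIV)"
  shows "artin_lift G g (artin_class S m w) = word_eval G g w"
proof -
  have "(SOME w'. w' \<in> artin_class S m w) \<in> artin_class S m w"
    using artin_class_self[OF assms] by (rule someI)
  then show ?thesis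
    unfolding artin_lift_def by (metis artin_class_def mem_Collect_eq word_eval_artin_eq)
qed

lemma lift_hom: "artin_lift G g \<in> hom (artin_group S m) G"
  by (rule homI) (auto simp: artin_carrier lift_class eval_closed artin_class_mult eval_append)

lemma lift_one: "artin_lift G g \<one>\<^bsub>artin_group S m\<^esub> = \<one>"
  by (simp add: artin_one lift_class)

lemma lift_gen: "s \<in> S \<Longrightarrow> artin_lift G g (artin_gen S m s) = g (s, True)"
  by (simp add: artin_gen_def lift_class letter_closed)

lemma lift_inv_gen:
  "s \<in> S \<Longrightarrow> artin_lift G g (inv\<^bsub>artin_group S m\<^esub> artin_gen S m s) = g (s, False)"
  by (simp add: artin_inv_gen lift_class letter_closed)

lemma lift_alt_prod:
  "x \<in> carrier (artin_group S m) \<Longrightarrow> y \<in> carrier (artin_group S m) \<Longrightarrow>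
    artin_lift G g (alt_prod (artin_group S m) x y n) =
    alt_prod G (artin_lift G g x) (artin_lift G g y) n"
  by (intro hom_alt_prod artin_group_monoid lift_hom lift_one)

text \<open>Turns membership in a parabolic subgroup into an induction over images of letters; it
  serves to show that every element of the subgroup generated by \<open>b\<close> and
  \<open>c\<close> acts affinely.\<close>

lemma lift_parabolic_induct:
  assumes "x \<in> parabolic S m X" "X \<subseteq> S"
    and "P \<one>" "\<And>s b. s \<in> X \<Longrightarrow> P (g (s, b))"
    and "\<And>y z. P y \<Longrightarrow> P z \<Longrightarrow> P (y \<otimes> z)"
  shows "P (artin_lift G g x)"
  using assms(1) unfolding parabolic_def
proof (induction rule: generate.induct)
  case one
  then show ?case using assms by (simp add: lift_one)
next
  case (incl h)
  then show ?case using assms by (auto simp: lift_gen subset_iff)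
next
  case (inv h)
  then show ?case using assms by (auto simp: lift_inv_gen subset_iff)
next
  case (eng h1 h2)
  have "generate (artin_group S m) (artin_gen S m ` X) \<subseteq> carrier (artin_group S m)"
    using assms(2) by (intro group.generate_incl artin_group_group artin_gen_image_closed)
  then have "h1 \<in> carrier (artin_group S m)" "h2 \<in> carrier (artin_group S m)"
    using eng by auto
  with eng show ?case using assms(5) by (simp add: hom_mult[OF lift_hom])
qed

end

section \<open>A deformed reflection representation\<close>

definition fun_monoid :: "('v \<Rightarrow> 'v) monoid" where
  "fun_monoid = \<lparr>carrier = UNIV, mult = (\<circ>), one = id\<rparr>"

lemma fun_monoid_simps [simp]:
  "carrier fun_monoid = UNIV" "f \<otimes>\<^bsub>fun_monoid\<^esub> g = f \<circ> g" "\<one>\<^bsub>fun_monoid\<^esub> = id"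
  by (simp_all add: fun_monoid_def)

lemma fun_monoid_monoid: "monoid fun_monoid"
  by unfold_locales (auto simp: comp_assoc)

text \<open>Passes from maps on vectors to their effect on one coordinate, as long as the vectors
  stay in the invariant set \<open>P\<close>.\<close>

lemma alt_prod_semiconj:
  assumes "\<And>v. P v \<Longrightarrow> P (f v) \<and> \<pi> (f v) = f' (\<pi> v)"
    and "\<And>v. P v \<Longrightarrow> P (g v) \<and> \<pi> (g v) = g' (\<pi> v)"
    and "P v"
  shows "P (alt_prod fun_monoid f g n v) \<and>
    \<pi> (alt_prod fun_monoid f g n v) = alt_prod fun_monoid f' g' n (\<pi> v)"
  using assms
proof (induction n arbitrary: f g f' g')
  case (Suc n)
  from Suc.IH[of g g' f f'] Suc.prems show ?case by auto
qed simp

text \<open>A rank-one perturbation of the identity: it multiplies \<open>e\<close> by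
  \<open>1 + e s\<close> and fixes every vector that vanishes at \<open>s\<close>.\<close>

definition transvect :: "('a \<Rightarrow> 'k) \<Rightarrow> 'a \<Rightarrow> ('a \<Rightarrow> 'k) \<Rightarrow> 'a \<Rightarrow> 'k::field" where
  "transvect e s v = (\<lambda>u. v u + v s * e u)"

text \<open>\<open>h\<close> is a two-parameter Chebyshev sequence, and \<open>c\<close> sums it
  with the two coordinates as alternating weights. The recurrence of \<open>h\<close> yields one for
  \<open>c\<close>, which is the effect of one more factor on the left.\<close>

lemma alt_prod_transvect:
  fixes e f :: "'a \<Rightarrow> 'k::field" and h :: "nat \<Rightarrow> 'k"
  assumes "h 0 = 0" "h 1 = 1" "\<And>n. h (n + 2) = \<kappa> * h (n + 1) + \<tau> * h n"
    and "e s = \<tau> - 1" "f t = \<tau> - 1" "e t = \<kappa>" "f s = \<kappa>"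
  defines "c \<equiv> \<lambda>x y n. \<Sum>i<n. h (Suc i) * (if even i then x else y)"
  shows "alt_prod fun_monoid (transvect e s) (transvect f t) (Suc n) v =
    (\<lambda>u. v u + c (v s) (v t) (Suc n) * e u + c (v t) (v s) n * f u)"
  using assms(4-7)
proof (induction n arbitrary: e f s t)
  case 0
  then show ?case by (auto simp: transvect_def c_def assms(1,2)[simplified])
next
  case (Suc n)
  have rec: "c x y (Suc (Suc n)) = x + \<kappa> * c y x (Suc n) + \<tau> * c x y n" for x y
  proof (induction n)
    case 0
    then show ?case using assms(3)[of 0] assms(1,2) by (simp add: c_def)
  next
    case (Suc n)
    have "c x y (Suc (Suc (Suc n))) = c x y (Suc (Suc n)) + h (n + 3) * (if even n then x else y)"
      by (simp add: c_def numeral_3_eq_3)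
    also have "h (n + 3) = \<kappa> * h (n + 2) + \<tau> * h (n + 1)"
      using assms(3)[of "n + 1"] by (simp add: numeral_3_eq_3)
    finally show ?case unfolding Suc
      by (simp add: c_def algebra_simps)
  qed
  have step: "alt_prod fun_monoid (transvect e s) (transvect f t) (Suc (Suc n)) v =
    transvect e s (\<lambda>u. v u + c (v t) (v s) (Suc n) * f u + c (v s) (v t) n * e u)"
    using Suc.IH[of f t e s] Suc.prems by simp
  show ?case
    unfolding step rec by (simp add: transvect_def Suc.prems) (simp add: algebra_simps)
qed

text \<open>When \<open>h k = 0\<close>, the last summand of the longer coefficient vanishes, and
  the formula of \<open>alt_prod_transvect\<close> becomes symmetric in the two maps.\<close>

lemma alt_prod_transvect_braid:
  fixes e f :: "'a \<Rightarrow> 'k::field" and h :: "nat \<Rightarrow> 'k"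
  assumes "h 0 = 0" "h 1 = 1" "\<And>n. h (n + 2) = \<kappa> * h (n + 1) + \<tau> * h n" "h k = 0"
    and "e s = \<tau> - 1" "f t = \<tau> - 1" "e t = \<kappa>" "f s = \<kappa>"
  shows "alt_prod fun_monoid (transvect e s) (transvect f t) k =
    alt_prod fun_monoid (transvect f t) (transvect e s) k"
proof (cases k)
  case (Suc n)
  show ?thesis
    unfolding Suc
    using assms(4) Suc alt_prod_transvect[where h = h, OF assms(1-3,5-8)]
      alt_prod_transvect[where h = h, OF assms(1-3,6,5,8,7)]
    by (auto simp: algebra_simps)
qed simp

text \<open>An infinite label imposes no relation, so it may be given any finite value \<open>N\<close>.\<close>

definition fin_label :: "('a \<Rightarrow> 'a \<Rightarrow> enat) \<Rightarrow> nat \<Rightarrow> 'a \<Rightarrow> 'a \<Rightarrow> nat" where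
  "fin_label m N s t = (case m s t of enat k \<Rightarrow> k | \<infinity> \<Rightarrow> N)"

text \<open>At \<open>z = 1\<close> the entries -2 and 2 cos(pi/m) are those of the geometric
  representation of the Coxeter group. For general \<open>z\<close> the generator multiplies its own
  row by \<open>- z\<^sup>2\<close>.\<close>

definition refl_row :: "('a \<Rightarrow> 'a \<Rightarrow> enat) \<Rightarrow> nat \<Rightarrow> complex \<Rightarrow> 'a \<Rightarrow> 'a \<Rightarrow> complex" where
  "refl_row m N z s t = (if s = t then - z\<^sup>2 - 1 else z * of_real (2 * cos (pi / fin_label m N s t)))"

text \<open>If \<open>1 + e s = - z\<^sup>2\<close>, the inverse of the transvection along
  \<open>e\<close> is the one along \<open>e\<close> divided by \<open>z\<^sup>2\<close>.\<close>

definition refl_letter ::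
  "('a \<Rightarrow> 'a \<Rightarrow> enat) \<Rightarrow> nat \<Rightarrow> complex \<Rightarrow> 'a \<times> bool \<Rightarrow> ('a \<Rightarrow> complex) \<Rightarrow> 'a \<Rightarrow> complex" where
  "refl_letter m N z l =
     (if snd l then transvect (refl_row m N z (fst l)) (fst l)
      else transvect (\<lambda>u. refl_row m N z (fst l) u / z\<^sup>2) (fst l))"

lemma refl_assignment:
  assumes "coxeter_matrix S m" "z \<noteq> 0"
  shows "artin_assignment fun_monoid S m (refl_letter m N z)"
proof -
  have braid: "alt_prod fun_monoid (refl_letter m N z (s, True)) (refl_letter m N z (t, True)) k =
      alt_prod fun_monoid (refl_letter m N z (t, True)) (refl_letter m N z (s, True)) k"
    if st: "s \<in> S" "t \<in> S" "s \<noteq> t" "m s t = enat k" for s t k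
  proof -
    have ts: "m t s = enat k" and "enat k \<ge> 2"
      using assms(1) st unfolding coxeter_matrix_def by metis+
    then have k: "k \<ge> 2" by (simp add: numeral_eq_enat)
    define \<alpha> where "\<alpha> = pi / k"
    have "0 < \<alpha>" "\<alpha> < pi" using k by (auto simp: \<alpha>_def field_simps)
    then have sin: "sin \<alpha> \<noteq> 0" using sin_gt_zero by fastforce
    \<comment> \<open>\<open>X n\<close> is the Chebyshev value U_{n-1}(cos \<alpha>), and
      \<open>h n\<close> is z^(n-1) times it, written \<open>z ^ n / z\<close> to cover
      \<open>n = 0\<close>. The recurrence holds with \<kappa> = 2 z cos \<alpha> and \<tau> = -z^2,
      and \<open>h k\<close> vanishes because \<open>k * \<alpha> = pi\<close>.\<close>
    define X where "X n = complex_of_real (sin (n * \<alpha>) / sin \<alpha>)" for n :: nat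
    define h where "h n = z ^ n / z * X n" for n :: nat
    have sin_rec: "sin ((n + 2) * \<alpha>) = 2 * cos \<alpha> * sin ((n + 1) * \<alpha>) - sin (n * \<alpha>)" for n :: real
    proof -
      have "sin ((n + 1) * \<alpha> + \<alpha>) + sin ((n + 1) * \<alpha> - \<alpha>) = 2 * cos \<alpha> * sin ((n + 1) * \<alpha>)"
        by (simp add: sin_add sin_diff)
      then show ?thesis by (simp add: algebra_simps)
    qed
    have X_rec: "X (n + 2) = of_real (2 * cos \<alpha>) * X (n + 1) - X n" for n
    proof -
      have "sin ((n + 2 :: nat) * \<alpha>) / sin \<alpha> =
          2 * cos \<alpha> * (sin ((n + 1 :: nat) * \<alpha>) / sin \<alpha>) - sin (n * \<alpha>) / sin \<alpha>"
        using sin_rec[of n] by (simp add: add_divide_distrib diff_divide_distrib add.commute)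
      then show ?thesis unfolding X_def by (simp only: of_real_diff of_real_mult)
    qed
    have "h (n + 2) = z * of_real (2 * cos \<alpha>) * h (n + 1) + (- z\<^sup>2) * h n" for n
      unfolding h_def X_rec using assms(2) by (simp add: field_simps power2_eq_square)
    moreover have "h 0 = 0" "h 1 = 1" "h k = 0"
      using assms(2) sin k by (auto simp: h_def X_def \<alpha>_def)
    ultimately show ?thesis
      using st ts unfolding refl_letter_def
      by (simp, intro alt_prod_transvect_braid[where h = h])
        (auto simp: refl_row_def fin_label_def \<alpha>_def)
  qed
  interpret monoid "fun_monoid :: (('a \<Rightarrow> complex) \<Rightarrow> 'a \<Rightarrow> complex) monoid"
    by (rule fun_monoid_monoid)
  show ?thesis
  proof
    fix s b
    show "refl_letter m N z (s, b) \<otimes>\<^bsub>fun_monoid\<^esub> refl_letter m N z (s, \<not> b) = \<one>\<^bsub>fun_monoid\<^esub>"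
      using assms(2) by (auto simp: refl_letter_def transvect_def refl_row_def fun_eq_iff field_simps)
  qed (auto intro: braid)
qed

section \<open>Alternating products of affine maps\<close>

lemma alt_prod_affine:
  fixes t s t' s' :: "'k::field"
  shows "\<exists>c. alt_prod fun_monoid (\<lambda>x. t * x + s) (\<lambda>x. t' * x + s') n =
    (\<lambda>x. t ^ (Suc n div 2) * t' ^ (n div 2) * x + c)"
proof (induction n arbitrary: t s t' s')
  case 0
  then show ?case by (auto intro: exI[of _ 0])
next
  case (Suc n)
  obtain c where "alt_prod fun_monoid (\<lambda>x. t' * x + s') (\<lambda>x. t * x + s) n =
    (\<lambda>x. t' ^ (Suc n div 2) * t ^ (n div 2) * x + c)" using Suc by blast
  then show ?case by (intro exI[of _ "t * c + s"]) (auto simp: algebra_simps)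
qed

text \<open>For \<open>n = 2 * k + 1\<close> the two slopes are t^(k+1) t'^k and t'^(k+1) t^k; the
  common nonzero factor cancels.\<close>

lemma affine_braid_slope:
  fixes t s t' s' :: "'k::field"
  assumes "alt_prod fun_monoid (\<lambda>x. t * x + s) (\<lambda>x. t' * x + s') n =
      alt_prod fun_monoid (\<lambda>x. t' * x + s') (\<lambda>x. t * x + s) n"
    and "odd n" "t \<noteq> 0" "t' \<noteq> 0"
  shows "t = t'"
proof -
  obtain k where n: "n = 2 * k + 1" using \<open>odd n\<close> by (rule oddE)
  obtain c d where "alt_prod fun_monoid (\<lambda>x. t * x + s) (\<lambda>x. t' * x + s') n =
      (\<lambda>x. t ^ Suc k * t' ^ k * x + c)"
    and "alt_prod fun_monoid (\<lambda>x. t' * x + s') (\<lambda>x. t * x + s) n =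
      (\<lambda>x. t' ^ Suc k * t ^ k * x + d)"
    using alt_prod_affine[of t s t' s' n] alt_prod_affine[of t' s' t s n] n by auto
  with assms(1) have "(\<lambda>x. t ^ Suc k * t' ^ k * x + c) = (\<lambda>x. t' ^ Suc k * t ^ k * x + d)"
    by (simp only:)
  from fun_cong[OF this, of 0] fun_cong[OF this, of 1] assms(3,4)
  show ?thesis by auto
qed

text \<open>Both products have slope t^n, so they differ by a constant, which is
  \<open>s - s'\<close> times a geometric sum in \<open>- t\<close>. That sum times
  \<open>- t - 1\<close> is \<open>(- t) ^ n - 1\<close>.\<close>

lemma affine_braid_shift:
  fixes t s s' :: "'k::field"
  assumes "alt_prod fun_monoid (\<lambda>x. t * x + s) (\<lambda>x. t * x + s') n =
      alt_prod fun_monoid (\<lambda>x. t * x + s') (\<lambda>x. t * x + s) n"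
  shows "s = s' \<or> (- t) ^ n = 1"
proof -
  have "alt_prod fun_monoid (\<lambda>x. t * x + s) (\<lambda>x. t * x + s') n x -
      alt_prod fun_monoid (\<lambda>x. t * x + s') (\<lambda>x. t * x + s) n x = (s - s') * (\<Sum>i<n. (- t) ^ i)" for x
  proof (induction n)
    case (Suc n)
    have "(\<Sum>i<Suc n. (- t) ^ i) = 1 - t * (\<Sum>i<n. (- t) ^ i)"
      unfolding sum.lessThan_Suc_shift by (simp add: sum_distrib_left sum_negf)
    then have "(s - s') * (\<Sum>i<Suc n. (- t) ^ i) = s - s' - t * ((s - s') * (\<Sum>i<n. (- t) ^ i))"
      by (simp only:) (simp add: algebra_simps)
    then show ?case unfolding Suc[symmetric] by (simp add: right_diff_distrib)
  qed simp
  then have "(s - s') * (\<Sum>i<n. (- t) ^ i) = 0" using assms by (metis cancel_comm_monoid_add_class.diff_cancel)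
  moreover have "(- t) ^ n - 1 = (- t - 1) * (\<Sum>i<n. (- t) ^ i)"
    by (rule power_diff_1_eq)
  ultimately show ?thesis by auto
qed

section \<open>Label conditions forced by retractions of triangles\<close>

text \<open>\<open>w\<close> is the image of \<open>a\<close>; the retraction fixes \<open>b\<close>
  and \<open>c\<close>, so it carries the relations between \<open>a\<close> and each of them over
  to \<open>w\<close>.\<close>

lemma retraction_braid:
  assumes "a \<in> S" "b \<in> S" "c \<in> S" "a \<noteq> b" "a \<noteq> c"
    and "has_retraction ((artin_group S m)\<lparr>carrier := parabolic S m {a, b, c}\<rparr>) (parabolic S m {b, c})"
  obtains w where "w \<in> parabolic S m {b, c}"
    and "\<And>x k. x \<in> {b, c} \<Longrightarrow> m a x = enat k \<Longrightarrow>
      alt_prod (artin_group S m) w (artin_gen S m x) k = alt_prod (artin_group S m) (artin_gen S m x) w k"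
proof -
  let ?A = "artin_group S m" and ?K = "parabolic S m {a, b, c}" and ?H = "parabolic S m {b, c}"
  interpret A: group ?A by (rule artin_group_group)
  have K: "subgroup ?K ?A" and H: "subgroup ?H ?A"
    using assms by (auto intro!: parabolic_subgroup)
  have GK: "group (?A\<lparr>carrier := ?K\<rparr>)" and GH: "group (?A\<lparr>carrier := ?H\<rparr>)"
    using K H by (auto intro: A.subgroup_imp_group)
  obtain \<phi> where hom: "\<phi> \<in> hom (?A\<lparr>carrier := ?K\<rparr>) (?A\<lparr>carrier := ?H\<rparr>)"
    and fix_H: "\<forall>h\<in>?H. \<phi> h = h"
    using assms(6) by (auto simp: has_retraction_def)
  have gens: "artin_gen S m x \<in> ?K" if "x \<in> {a, b, c}" for x
    using that by (rule artin_gen_in_parabolic)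
  have \<phi>_alt: "\<phi> (alt_prod ?A x y k) = alt_prod ?A (\<phi> x) (\<phi> y) k" if "x \<in> ?K" "y \<in> ?K" for x y k
    using hom_alt_prod[OF group.is_monoid[OF GK] hom hom_one[OF hom GK GH], of x y k] that by simp
  show ?thesis
  proof
    show "\<phi> (artin_gen S m a) \<in> ?H"
      using hom gens[of a] by (auto simp: hom_def)
  next
    fix x k assume x: "x \<in> {b, c}" and k: "m a x = enat k"
    have "\<phi> (artin_gen S m x) = artin_gen S m x"
      using fix_H x by (blast intro: artin_gen_in_parabolic)
    moreover have "alt_prod ?A (artin_gen S m a) (artin_gen S m x) k =
        alt_prod ?A (artin_gen S m x) (artin_gen S m a) k"
      using x k assms by (intro artin_gen_braid) auto
    moreover have "artin_gen S m x \<in> ?K" "artin_gen S m a \<in> ?K"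
      using x by (auto intro: gens)
    ultimately show "alt_prod ?A (\<phi> (artin_gen S m a)) (artin_gen S m x) k =
        alt_prod ?A (artin_gen S m x) (\<phi> (artin_gen S m a)) k"
      by (metis \<phi>_alt)
  qed
qed

section \<open>Affine actions on an invariant line\<close>

definition acts_affinely ::
  "(('a \<Rightarrow> 'k) \<Rightarrow> bool) \<Rightarrow> 'a \<Rightarrow> 'k::field \<Rightarrow> 'k \<Rightarrow> (('a \<Rightarrow> 'k) \<Rightarrow> 'a \<Rightarrow> 'k) \<Rightarrow> bool" where
  "acts_affinely P b t s f \<longleftrightarrow> t \<noteq> 0 \<and> (\<forall>v. P v \<longrightarrow> P (f v) \<and> f v b = t * v b + s)"

lemma acts_affinely_id: "acts_affinely P b 1 0 id"
  by (simp add: acts_affinely_def)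

lemma acts_affinely_comp:
  "acts_affinely P b t s f \<Longrightarrow> acts_affinely P b t' s' g \<Longrightarrow>
    acts_affinely P b (t * t') (t * s' + s) (f \<circ> g)"
  by (simp add: acts_affinely_def algebra_simps)

text \<open>Coordinate \<open>b\<close> takes every value on \<open>P\<close>, so a relation between
  \<open>f\<close> and \<open>g\<close> forces the same relation between the affine maps they
  induce.\<close>

lemma acts_affinely_braid:
  assumes "acts_affinely P b t s f" "acts_affinely P b t' s' g" "\<forall>x. \<exists>v. P v \<and> v b = x"
    and "alt_prod fun_monoid f g k = alt_prod fun_monoid g f k"
  shows "alt_prod fun_monoid (\<lambda>x. t * x + s) (\<lambda>x. t' * x + s') k =
    alt_prod fun_monoid (\<lambda>x. t' * x + s') (\<lambda>x. t * x + s) k"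
proof
  fix x
  obtain v where v: "P v" "v b = x" using assms(3) by blast
  show "alt_prod fun_monoid (\<lambda>x. t * x + s) (\<lambda>x. t' * x + s') k x =
      alt_prod fun_monoid (\<lambda>x. t' * x + s') (\<lambda>x. t * x + s) k x"
    using alt_prod_semiconj[of P f "\<lambda>v. v b" "\<lambda>x. t * x + s" g "\<lambda>x. t' * x + s'" v k]
      alt_prod_semiconj[of P g "\<lambda>v. v b" "\<lambda>x. t' * x + s'" f "\<lambda>x. t * x + s" v k]
      assms(1,2,4) v unfolding acts_affinely_def by simp
qed

text \<open>The real part gives cos(2 pi n / r) = 1, so n / r is an integer.\<close>

lemma cis_power_eq_1:
  assumes "(cis (2 * pi / real r)) ^ n = 1" "r > 0"
  shows "r dvd n"
proof -
  have "cos (n * (2 * pi / r)) = 1"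
    using arg_cong[OF assms(1), of Re] by (simp add: DeMoivre)
  then obtain i :: int where "n * (2 * pi / r) = i * 2 * pi" by (auto simp: cos_one_2pi_int)
  then have "real n = real_of_int i * real r" using assms(2) by (simp add: field_simps)
  then have "int n = i * int r" by (metis of_int_eq_iff of_int_mult of_int_of_nat_eq)
  then have "int r dvd int n" by simp
  then show ?thesis by simp
qed

text \<open>The letters of \<open>w\<close> act affinely, hence so does \<open>w\<close>. The pair
  \<open>t\<close>, \<open>s\<close> is fixed before \<open>x\<close> and \<open>k\<close>, so
  relations with \<open>b\<close> and with \<open>c\<close> constrain one and the same affine
  map.\<close>

lemma parabolic_acts_affinely:
  assumes "coxeter_matrix S m" "z \<noteq> 0" "b \<in> S" "c \<in> S" "w \<in> parabolic S m {b, c}"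
    and surj: "\<forall>x. \<exists>v. P v \<and> v b = x"
    and letters: "\<forall>x\<in>{b, c}. \<forall>e. \<exists>t s. acts_affinely P b t s (refl_letter m N z (x, e))"
  obtains t s where "t \<noteq> 0"
    and "\<And>x k t' s'. alt_prod (artin_group S m) w (artin_gen S m x) k =
        alt_prod (artin_group S m) (artin_gen S m x) w k \<Longrightarrow>
      x \<in> {b, c} \<Longrightarrow> acts_affinely P b t' s' (refl_letter m N z (x, True)) \<Longrightarrow>
      alt_prod fun_monoid (\<lambda>x. t * x + s) (\<lambda>x. t' * x + s') k =
      alt_prod fun_monoid (\<lambda>x. t' * x + s') (\<lambda>x. t * x + s) k"
proof -
  interpret artin_assignment fun_monoid S m "refl_letter m N z"
    using assms(1,2) by (rule refl_assignment)
  let ?\<rho> = "artin_lift fun_monoid (refl_letter m N z)"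
  have "parabolic S m {b, c} \<subseteq> carrier (artin_group S m)"
    using assms by (intro subgroup.subset parabolic_subgroup) auto
  then have w: "w \<in> carrier (artin_group S m)" using assms by blast
  have "\<exists>t s. acts_affinely P b t s (?\<rho> w)"
    using assms(5)
  proof (rule lift_parabolic_induct)
    show "{b, c} \<subseteq> S" using assms by simp
    show "\<exists>t s. acts_affinely P b t s \<one>\<^bsub>fun_monoid\<^esub>"
      using acts_affinely_id[of P b] by (simp only: fun_monoid_simps) blast
    show "\<exists>t s. acts_affinely P b t s (refl_letter m N z (x, e))" if "x \<in> {b, c}" for x e
      using that letters by blast
    show "\<exists>t s. acts_affinely P b t s (f \<otimes>\<^bsub>fun_monoid\<^esub> g)"
      if "\<exists>t s. acts_affinely P b t s f" "\<exists>t s. acts_affinely P b t s g" for f g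
      using that acts_affinely_comp[of P b _ _ f _ _ g] by (simp only: fun_monoid_simps) blast
  qed
  then obtain t s where ts: "acts_affinely P b t s (?\<rho> w)" by blast
  show ?thesis
  proof
    show "t \<noteq> 0" using ts by (simp add: acts_affinely_def)
  next
    fix x k t' s'
    assume braid: "alt_prod (artin_group S m) w (artin_gen S m x) k =
        alt_prod (artin_group S m) (artin_gen S m x) w k"
      and x: "x \<in> {b, c}" "acts_affinely P b t' s' (refl_letter m N z (x, True))"
    have "x \<in> S" using x assms by auto
    then have "alt_prod fun_monoid (?\<rho> w) (refl_letter m N z (x, True)) k =
        alt_prod fun_monoid (refl_letter m N z (x, True)) (?\<rho> w) k"
      using arg_cong[OF braid, of ?\<rho>] w by (simp add: lift_alt_prod artin_gen_closed lift_gen)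
    with ts x(2) surj show "alt_prod fun_monoid (\<lambda>x. t * x + s) (\<lambda>x. t' * x + s') k =
        alt_prod fun_monoid (\<lambda>x. t' * x + s') (\<lambda>x. t * x + s) k"
      by (rule acts_affinely_braid)
  qed
qed

lemma triangle_labels:
  assumes cox: "coxeter_matrix S m" and S: "a \<in> S" "b \<in> S" "c \<in> S"
    and dist: "a \<noteq> b" "a \<noteq> c" "b \<noteq> c"
    and retr: "has_retraction ((artin_group S m)\<lparr>carrier := parabolic S m {a, b, c}\<rparr>)
      (parabolic S m {b, c})"
    and p: "m a b = enat p" "odd p" and q: "m a c = enat q"
  shows "\<exists>r. m b c = enat r \<and> (r dvd p \<or> r dvd q)"
proof -
  have c_in: "c \<in> {b, c}" by simp
  \<comment> \<open>\<open>N\<close> exceeds both \<open>p\<close> and \<open>q\<close>. If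
    \<open>m b c\<close> were infinite, \<open>r\<close> would be \<open>N\<close>, which divides
    neither; this excludes infinity at the end.\<close>
  define N where "N = p + q + 3"
  define r where "r = fin_label m N b c"
  have cb: "m c b = m b c" and bc2: "m b c \<ge> 2" and ac2: "m a c \<ge> 2"
    using cox S dist unfolding coxeter_matrix_def by metis+
  have rcb: "fin_label m N c b = r" by (simp add: r_def fin_label_def cb)
  have "q \<ge> 2" using ac2 q by (simp add: numeral_eq_enat)
  have "r \<ge> 2"
    using bc2 by (auto simp: r_def fin_label_def N_def numeral_eq_enat split: enat.split)
  obtain w where w: "w \<in> parabolic S m {b, c}"
    and braid: "\<And>x k. x \<in> {b, c} \<Longrightarrow> m a x = enat k \<Longrightarrow>
      alt_prod (artin_group S m) w (artin_gen S m x) k = alt_prod (artin_group S m) (artin_gen S m x) w k"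
    using retraction_braid[OF S dist(1,2) retr] by blast
  have "r dvd p \<or> r dvd q"
  proof (cases "r = 2")
    case True
    \<comment> \<open>For \<open>r = 2\<close> the off-diagonal entry 2 cos(pi/2) is zero, so
      coordinate \<open>b\<close> is negated by \<open>b\<close> and fixed by \<open>c\<close>. The
      odd \<open>p\<close> gives \<open>w\<close> slope -1, while an odd \<open>q\<close> would give
      it slope 1; hence \<open>q\<close> is even.\<close>
    have row: "refl_row m N 1 b c = 0" "refl_row m N 1 c b = 0"
      using True rcb dist by (auto simp: refl_row_def r_def)
    let ?P = "\<lambda>v :: 'a \<Rightarrow> complex. True"
    have letters: "acts_affinely ?P b (- 1) 0 (refl_letter m N 1 (b, e))"
        "acts_affinely ?P b 1 0 (refl_letter m N 1 (c, e))" for e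
      using row by (auto simp: acts_affinely_def refl_letter_def transvect_def refl_row_def)
    have surj: "\<forall>x. \<exists>v. ?P v \<and> v b = x" by auto
    have ex: "\<forall>x\<in>{b, c}. \<forall>e. \<exists>t s. acts_affinely ?P b t s (refl_letter m N 1 (x, e))"
      using letters by blast
    obtain t s where "t \<noteq> 0" and
      ts: "\<And>x k t' s'. alt_prod (artin_group S m) w (artin_gen S m x) k =
          alt_prod (artin_group S m) (artin_gen S m x) w k \<Longrightarrow>
        x \<in> {b, c} \<Longrightarrow> acts_affinely ?P b t' s' (refl_letter m N 1 (x, True)) \<Longrightarrow>
        alt_prod fun_monoid (\<lambda>x. t * x + s) (\<lambda>x. t' * x + s') k =
        alt_prod fun_monoid (\<lambda>x. t' * x + s') (\<lambda>x. t * x + s) k"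
      using parabolic_acts_affinely[OF cox one_neq_zero S(2,3) w surj ex] by blast
    have "t = - 1"
      by (rule affine_braid_slope[OF ts[OF braid[OF insertI1 p(1)] insertI1 letters(1)] p(2) \<open>t \<noteq> 0\<close>])
        simp
    moreover have "t = 1" if "odd q"
      by (rule affine_braid_slope[OF ts[OF braid[OF c_in q] c_in letters(2)] that \<open>t \<noteq> 0\<close>])
        simp
    ultimately show ?thesis using True by auto
  next
    case False
    then have r3: "r \<ge> 3" using \<open>r \<ge> 2\<close> by simp
    \<comment> \<open>Now \<open>z\<^sup>2\<close>, that is \<open>- \<tau>\<close>, is a primitive
      \<open>r\<close>-th root of unity, and the off-diagonal entry becomes
      \<open>1 - \<tau>\<close>, the negative of the diagonal one.\<close>
    define z where "z = cis (pi / r)"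
    define \<tau> where "\<tau> = - z\<^sup>2"
    have "z \<noteq> 0" by (simp add: z_def)
    have minus_\<tau>: "- \<tau> = cis (2 * pi / r)" by (simp add: \<tau>_def z_def DeMoivre)
    have "\<tau> \<noteq> 0" using \<open>z \<noteq> 0\<close> by (simp add: \<tau>_def)
    have "z * of_real (2 * cos (pi / r)) = z * (z + cnj z)"
      by (simp add: z_def complex_eq_iff)
    also have "\<dots> = 1 - \<tau>"
      by (simp add: \<tau>_def z_def algebra_simps power2_eq_square cis_cnj cis_mult)
    finally have row: "refl_row m N z b c = 1 - \<tau>" "refl_row m N z c b = 1 - \<tau>"
        "refl_row m N z b b = \<tau> - 1" "refl_row m N z c c = \<tau> - 1"
      using rcb dist by (auto simp: refl_row_def r_def \<tau>_def)
    \<comment> \<open>Since the entries are opposite, both generators preserve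
      \<open>v b + v c\<close>, and \<open>?P\<close> is its level set at 1. There \<open>b\<close>
      fixes the value 0 of the coordinate and \<open>c\<close> the value 1.\<close>
    let ?P = "\<lambda>v :: 'a \<Rightarrow> complex. v c = 1 - v b"
    have letters_True: "acts_affinely ?P b \<tau> 0 (refl_letter m N z (b, True))"
        "acts_affinely ?P b \<tau> (1 - \<tau>) (refl_letter m N z (c, True))"
      using \<open>\<tau> \<noteq> 0\<close>
      by (auto simp: acts_affinely_def refl_letter_def transvect_def row) (simp_all add: algebra_simps)
    have z2: "z\<^sup>2 = - \<tau>" by (simp add: \<tau>_def)
    have letters_False: "acts_affinely ?P b (1 / \<tau>) 0 (refl_letter m N z (b, False))"
        "acts_affinely ?P b (1 / \<tau>) (1 - 1 / \<tau>) (refl_letter m N z (c, False))"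
      using \<open>\<tau> \<noteq> 0\<close>
      by (auto simp: acts_affinely_def refl_letter_def transvect_def row z2) (simp_all add: field_simps)
    have surj: "\<forall>x. \<exists>v. ?P v \<and> v b = x"
    proof
      fix x show "\<exists>v. ?P v \<and> v b = x"
        using dist by (intro exI[of _ "\<lambda>u. if u = b then x else 1 - x"]) simp
    qed
    have ex: "\<forall>x\<in>{b, c}. \<forall>e. \<exists>t s. acts_affinely ?P b t s (refl_letter m N z (x, e))"
    proof (intro ballI allI)
      fix x e assume "x \<in> {b, c}"
      then show "\<exists>t s. acts_affinely ?P b t s (refl_letter m N z (x, e))"
        using letters_True letters_False by (cases e) auto
    qed
    obtain t s where "t \<noteq> 0" and
      ts: "\<And>x k t' s'. alt_prod (artin_group S m) w (artin_gen S m x) k =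
          alt_prod (artin_group S m) (artin_gen S m x) w k \<Longrightarrow>
        x \<in> {b, c} \<Longrightarrow> acts_affinely ?P b t' s' (refl_letter m N z (x, True)) \<Longrightarrow>
        alt_prod fun_monoid (\<lambda>x. t * x + s) (\<lambda>x. t' * x + s') k =
        alt_prod fun_monoid (\<lambda>x. t' * x + s') (\<lambda>x. t * x + s) k"
      using parabolic_acts_affinely[OF cox \<open>z \<noteq> 0\<close> S(2,3) w surj ex] by blast
    have tp: "alt_prod fun_monoid (\<lambda>x. t * x + s) (\<lambda>x. \<tau> * x + 0) p =
        alt_prod fun_monoid (\<lambda>x. \<tau> * x + 0) (\<lambda>x. t * x + s) p"
      by (rule ts[OF braid[OF insertI1 p(1)] insertI1 letters_True(1)])
    have "t = \<tau>"
      using tp p(2) \<open>t \<noteq> 0\<close> \<open>\<tau> \<noteq> 0\<close> by (rule affine_braid_slope)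
    have "s = 0 \<or> (- \<tau>) ^ p = 1"
      using tp unfolding \<open>t = \<tau>\<close> by (rule affine_braid_shift)
    moreover have "s = 1 - \<tau> \<or> (- \<tau>) ^ q = 1"
      using ts[OF braid[OF c_in q] c_in letters_True(2)] unfolding \<open>t = \<tau>\<close>
      by (rule affine_braid_shift)
    \<comment> \<open>This separates the translations 0 and \<open>1 - \<tau>\<close>:
      \<open>w\<close> cannot act both as \<open>b\<close> and as \<open>c\<close>, so one of the
      two powers must be 1.\<close>
    moreover have "\<tau> \<noteq> 1"
    proof
      assume "\<tau> = 1"
      then have "cis (2 * pi / r) ^ 2 = 1" by (simp flip: minus_\<tau>)
      then have "r dvd 2" using r3 by (intro cis_power_eq_1) auto
      then show False using r3 by (auto dest: dvd_imp_le)
    qed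
    ultimately have "(- \<tau>) ^ p = 1 \<or> (- \<tau>) ^ q = 1" by auto
    then show ?thesis unfolding minus_\<tau> using cis_power_eq_1 r3 by fastforce
  qed
  moreover have "m b c \<noteq> \<infinity>"
  proof
    assume "m b c = \<infinity>"
    then have "r = N" by (simp add: r_def fin_label_def)
    with \<open>r dvd p \<or> r dvd q\<close> have "N \<le> p \<or> N \<le> q"
      using p(2) \<open>q \<ge> 2\<close> by (auto dest!: dvd_imp_le intro: odd_pos)
    then show False by (simp add: N_def)
  qed
  ultimately show ?thesis by (auto simp: r_def fin_label_def)
qed

section \<open>Folding the odd classes\<close>

definition odd_label :: "('a \<Rightarrow> 'a \<Rightarrow> enat) \<Rightarrow> 'a \<Rightarrow> 'a \<Rightarrow> bool" where
  "odd_label m s t \<longleftrightarrow> (\<exists>k. odd k \<and> m s t = enat k)"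

text \<open>The divisibility condition is all that the construction of retractions takes from the
  hypothesis on triples. Below, different vertices of one triangle take the role of the apex
  \<open>a\<close>.\<close>

locale foldable_matrix =
  fixes S :: "'a set" and m :: "'a \<Rightarrow> 'a \<Rightarrow> enat"
  assumes coxeter: "coxeter_matrix S m"
    and triangle: "\<And>a b c p q. a \<in> S \<Longrightarrow> b \<in> S \<Longrightarrow> c \<in> S \<Longrightarrow> a \<noteq> b \<Longrightarrow> a \<noteq> c \<Longrightarrow> b \<noteq> c \<Longrightarrow>
      m a b = enat p \<Longrightarrow> odd p \<Longrightarrow> m a c = enat q \<Longrightarrow>
      \<exists>r. m b c = enat r \<and> (r dvd p \<or> r dvd q)"
begin

lemma label_sym: "s \<in> S \<Longrightarrow> t \<in> S \<Longrightarrow> m s t = m t s"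
  using coxeter unfolding coxeter_matrix_def by metis

lemma label_diag: "s \<in> S \<Longrightarrow> m s s = 1"
  using coxeter unfolding coxeter_matrix_def by blast

lemma odd_label_sym: "s \<in> S \<Longrightarrow> t \<in> S \<Longrightarrow> odd_label m s t \<Longrightarrow> odd_label m t s"
  unfolding odd_label_def by (simp add: label_sym)

lemma odd_label_refl: "s \<in> S \<Longrightarrow> odd_label m s s"
  unfolding odd_label_def by (auto simp: label_diag one_enat_def)

text \<open>With apex \<open>t\<close>, the third label divides one of two odd numbers.\<close>

lemma odd_label_trans:
  assumes "s \<in> S" "t \<in> S" "u \<in> S" "odd_label m s t" "odd_label m t u"
  shows "odd_label m s u"
proof (cases "s = t \<or> t = u \<or> s = u")
  case True
  then show ?thesis using assms odd_label_refl by blast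
next
  case False
  obtain p q where "m t s = enat p" "odd p" "m t u = enat q" "odd q"
    using assms label_sym unfolding odd_label_def by metis
  then obtain r where "m s u = enat r" "r dvd p \<or> r dvd q"
    using triangle[of t s u p q] assms False by auto
  then show ?thesis
    using \<open>odd p\<close> \<open>odd q\<close> dvd_trans[of 2 r] unfolding odd_label_def by blast
qed

text \<open>An even number cannot divide the odd \<open>p\<close>, so apex \<open>s'\<close> and
  apex \<open>s\<close> make the two labels towards \<open>t\<close> divide each other. If one of
  them is finite, so is the other.\<close>

lemma label_const_on_odd_class:
  assumes S: "s \<in> S" "s' \<in> S" "t \<in> S" and "odd_label m s s'" "\<not> odd_label m s t"
  shows "m s t = m s' t"
proof (cases "s = s'")
  case False
  have ne: "s \<noteq> t" "s' \<noteq> t" using assms odd_label_refl by auto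
  obtain p where p: "m s s' = enat p" "m s' s = enat p" "odd p"
    using assms label_sym unfolding odd_label_def by metis
  have even_ndvd: "\<not> d dvd p" if "even d" for d
    using that p(3) dvd_trans[of 2 d p] by blast
  show ?thesis
  proof (cases "m s t")
    case (enat q)
    with assms have "even q" by (auto simp: odd_label_def)
    obtain r where r: "m s' t = enat r" "r dvd p \<or> r dvd q"
      using triangle[of s s' t p q] S False ne p enat by auto
    have "q dvd p \<or> q dvd r"
      using triangle[of s' s t p r] S False ne p enat r by auto
    then have "q dvd r" using even_ndvd \<open>even q\<close> by simp
    then have "even r" using \<open>even q\<close> dvd_trans[of 2 q r] by simp
    then have "r dvd q" using r(2) even_ndvd by simp
    with \<open>q dvd r\<close> show ?thesis using enat r by (simp add: dvd_antisym)
  next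
    case infinity
    show ?thesis
    proof (cases "m s' t")
      case (enat k)
      then have "\<exists>r. m s t = enat r"
        using triangle[of s' s t p k] S False ne p by auto
      with infinity show ?thesis by simp
    qed (simp add: infinity)
  qed
qed simp

text \<open>Apex \<open>s\<close> bounds \<open>l\<close> by \<open>j\<close>, and apex
  \<open>t\<close> shows that \<open>j\<close> divides \<open>i\<close> or \<open>l\<close>. The
  first case forces \<open>i = j\<close>, the second \<open>l = j\<close>: the largest label occurs
  twice, as in an ultrametric.\<close>

lemma odd_triangle:
  assumes S: "s \<in> S" "t \<in> S" "u \<in> S" and "odd_label m s t" "odd_label m s u"
    and ij: "m s t = enat i" "m s u = enat j" "i \<le> j"
  obtains l where "m t u = enat l" "l dvd j" "i < j \<Longrightarrow> l = j"
proof (cases "s = t \<or> s = u \<or> t = u")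
  case True
  moreover have "i \<noteq> 0" using assms by (auto simp: odd_label_def intro: odd_pos)
  ultimately show ?thesis
    using that[of j] that[of 1] ij S label_diag label_sym by (auto simp: one_enat_def)
next
  case False
  have odd: "odd i" "odd j" using assms by (auto simp: odd_label_def)
  obtain l where l: "m t u = enat l" "l dvd i \<or> l dvd j"
    using triangle[of s t u i j] S False ij odd by auto
  then have "odd l" using odd dvd_trans[of 2 l] by blast
  have "j dvd i \<or> j dvd l"
    using triangle[of t s u i l] S False ij odd l label_sym by auto
  then have "l dvd j \<and> (i < j \<longrightarrow> l = j)"
  proof
    assume "j dvd i"
    then have "i = j" using ij(3) odd by (auto dest!: dvd_imp_le intro: odd_pos)
    then show ?thesis using l by auto
  next
    assume "j dvd l"
    have "l \<le> j" using l(2) ij(3) odd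
      by (meson dvd_imp_le le_trans odd_pos)
    moreover have "j \<le> l" using \<open>j dvd l\<close> \<open>odd l\<close> by (auto dest!: dvd_imp_le intro: odd_pos)
    ultimately show ?thesis by simp
  qed
  then show ?thesis using that l by blast
qed

section \<open>Nearest vertices in a subset\<close>

definition nearest :: "'a set \<Rightarrow> 'a \<Rightarrow> 'a set" where
  "nearest X s = {x \<in> X. odd_label m s x \<and> (\<forall>y\<in>X. odd_label m s y \<longrightarrow> m s x \<le> m s y)}"

text \<open>The choice depends only on the set \<open>nearest X s\<close>, so generators with the
  same nearest set go to the same vertex. \<open>None\<close> marks an odd class that misses
  \<open>X\<close>.\<close>

definition fold_vertex :: "'a set \<Rightarrow> 'a \<Rightarrow> 'a option" where
  "fold_vertex X s = (if nearest X s = {} then None else Some (SOME x. x \<in> nearest X s))"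

text \<open>Labels lie in the well-order \<open>enat\<close>, so a least one exists as soon as
  \<open>X\<close> contains a candidate.\<close>

lemma nearest_empty_iff: "nearest X s = {} \<longleftrightarrow> (\<forall>x\<in>X. \<not> odd_label m s x)"
proof
  show "\<forall>x\<in>X. \<not> odd_label m s x" if "nearest X s = {}"
  proof (rule ccontr)
    assume "\<not> ?thesis"
    then have "{x \<in> X. odd_label m s x} \<noteq> {}" by blast
    then obtain x where "x \<in> {x \<in> X. odd_label m s x}"
      "\<And>y. y \<in> {x \<in> X. odd_label m s x} \<Longrightarrow> m s x \<le> m s y"
      using exists_least_iff[of "\<lambda>k. \<exists>x\<in>{x \<in> X. odd_label m s x}. m s x = k"]
      by (metis (no_types, lifting) ex_in_conv linorder_not_le)
    then have "x \<in> nearest X s" by (auto simp: nearest_def)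
    with that show False by blast
  qed
qed (auto simp: nearest_def)

lemma fold_vertex_Some: "fold_vertex X s = Some x \<Longrightarrow> x \<in> nearest X s"
  unfolding fold_vertex_def by (auto split: if_splits intro: someI)

text \<open>The nearest vertex has label at most \<open>m s s = 1\<close>, while distinct vertices
  have label at least 2.\<close>

lemma fold_vertex_id:
  assumes "X \<subseteq> S" "s \<in> X"
  shows "fold_vertex X s = Some s"
proof -
  have s: "s \<in> S" using assms by blast
  then have "fold_vertex X s \<noteq> None"
    using assms odd_label_refl nearest_empty_iff[of X s] by (auto simp: fold_vertex_def)
  then obtain x where x: "fold_vertex X s = Some x" by blast
  then have "x \<in> X" "m s x \<le> m s s"
    using fold_vertex_Some[OF x] assms odd_label_refl[OF s] by (auto simp: nearest_def)
  then have "m s x \<le> 1" using s by (simp add: label_diag)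
  moreover have "m s x \<ge> 2" if "x \<noteq> s"
    using coxeter s \<open>x \<in> X\<close> assms that unfolding coxeter_matrix_def by (metis subsetD)
  ultimately have "x = s"
    by (cases "m s x") (auto simp: numeral_eq_enat one_enat_def)
  with x show ?thesis by simp
qed

lemma fold_vertex_None_cong:
  assumes "X \<subseteq> S" "s \<in> S" "t \<in> S" "odd_label m s t"
  shows "fold_vertex X s = None \<longleftrightarrow> fold_vertex X t = None"
proof -
  have "odd_label m s x \<longleftrightarrow> odd_label m t x" if "x \<in> X" for x
    using assms that odd_label_trans[of s t x] odd_label_trans[of t s x] odd_label_sym[of s t] by blast
  then show ?thesis by (simp add: fold_vertex_def nearest_empty_iff)
qed

text \<open>As \<open>m s x\<close> is below \<open>k\<close>, the ultrametric property gives
  \<open>m t x = k\<close>. So \<open>y\<close> is within \<open>k\<close> of \<open>t\<close>, and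
  the triangle \<open>t\<close>, \<open>y\<close>, \<open>x\<close> gives the divisor.\<close>

lemma fold_vertex_near:
  assumes "X \<subseteq> S" and S: "s \<in> S" "t \<in> S" and "odd_label m s t" and k: "m s t = enat k"
    and x: "x \<in> nearest X s" and y: "y \<in> nearest X t" and less: "m s x < enat k"
  obtains l where "m x y = enat l" "l dvd k"
proof -
  have xy: "x \<in> S" "y \<in> S" "odd_label m s x" "odd_label m t y"
    using x y assms(1) by (auto simp: nearest_def)
  obtain i where i: "m s x = enat i" using xy by (auto simp: odd_label_def)
  with less have "i < k" by simp
  then obtain l where "m x t = enat l" "i < k \<Longrightarrow> l = k"
    using odd_triangle[of s x t i k] S xy i k assms(4) by auto
  then have tx: "m t x = enat k" using \<open>i < k\<close> S xy label_sym by auto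
  then have otx: "odd_label m t x" using assms(4) k by (auto simp: odd_label_def)
  have "m t y \<le> m t x" using x y otx by (auto simp: nearest_def)
  then obtain j where j: "m t y = enat j" "j \<le> k" using tx by (cases "m t y") auto
  obtain l where "m y x = enat l" "l dvd k"
    using odd_triangle[of t y x j k] S xy otx j tx by auto
  then show ?thesis using that xy label_sym by auto
qed

text \<open>A vertex at label at least \<open>k\<close> from one endpoint is no farther from the
  other (\<open>below\<close>). For \<open>y\<close> this gives \<open>m s x \<le> m t y\<close>;
  for a nearest vertex of \<open>s\<close> it then shows that it is nearest to \<open>t\<close> as
  well.\<close>

lemma fold_vertex_far:
  assumes "X \<subseteq> S" and S: "s \<in> S" "t \<in> S" and "odd_label m s t" and k: "m s t = enat k"
    and x: "x \<in> nearest X s" and y: "y \<in> nearest X t" and le: "enat k \<le> m s x" "enat k \<le> m t y"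
  shows "nearest X s \<subseteq> nearest X t"
proof -
  have below: "odd_label m t' u \<and> m t' u \<le> m s' u"
    if "s' \<in> S" "t' \<in> S" "odd_label m s' t'" "m s' t' = enat k" "u \<in> nearest X s'" "enat k \<le> m s' u" for s' t' u
  proof -
    note prems = that
    have u: "u \<in> S" "odd_label m s' u" using that assms(1) by (auto simp: nearest_def)
    then obtain i where i: "m s' u = enat i" by (auto simp: odd_label_def)
    with that have "k \<le> i" by simp
    then obtain l where "m t' u = enat l" "l dvd i"
      using odd_triangle[of s' t' u k i] prems u i by auto
    moreover have "odd i" using u i by (auto simp: odd_label_def)
    ultimately show ?thesis
      using i dvd_trans[of 2 l i] by (auto simp: odd_label_def dvd_imp_le odd_pos)
  qed
  have ts: "odd_label m t s" "m t s = enat k" using assms(4) k S label_sym odd_label_sym by auto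
  have same: "m s u = m s x" if "u \<in> nearest X s" for u
    using that x by (auto simp: nearest_def intro: antisym)
  have "odd_label m s y" "m s y \<le> m t y"
    using below[OF S(2,1) ts y le(2)] by auto
  then have "m s x \<le> m t y" using x y by (auto simp: nearest_def intro: order_trans)
  show ?thesis
  proof
    fix u assume u: "u \<in> nearest X s"
    then have "odd_label m t u" "m t u \<le> m s u"
      using below[OF S assms(4) k u] le same by auto
    with \<open>m s x \<le> m t y\<close> same[OF u] have "m t u \<le> m t y" by simp
    moreover have "u \<in> X" using u by (simp add: nearest_def)
    ultimately show "u \<in> nearest X t"
      using y \<open>odd_label m t u\<close> by (auto simp: nearest_def intro: order_trans)
  qed
qed

text \<open>Inside a class, either an endpoint has a vertex closer than \<open>k\<close>, or the two
  nearest sets coincide and with them the choices. Between classes, each endpoint may be moved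
  within its class without changing the label.\<close>

lemma fold_vertex_label:
  assumes X: "X \<subseteq> S" and S: "s \<in> S" "t \<in> S" and k: "m s t = enat k"
    and x: "fold_vertex X s = Some x" and y: "fold_vertex X t = Some y"
  shows "x = y \<or> (\<exists>l. m x y = enat l \<and> l dvd k)"
proof -
  have near: "x \<in> nearest X s" "y \<in> nearest X t"
    using x y by (auto intro: fold_vertex_Some)
  then have xy: "x \<in> S" "y \<in> S" "odd_label m s x" "odd_label m t y"
    using X by (auto simp: nearest_def)
  show ?thesis
  proof (cases "odd_label m s t")
    case True
    have ts: "odd_label m t s" "m t s = enat k" using True k S label_sym odd_label_sym by auto
    consider "m s x < enat k" | "m t y < enat k" | "enat k \<le> m s x" "enat k \<le> m t y"
      by fastforce
    then show ?thesis
    proof cases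
      case 1
      then show ?thesis using fold_vertex_near[OF X S True k near] by metis
    next
      case 2
      then show ?thesis
        using fold_vertex_near[OF X S(2,1) ts near(2,1)] label_sym xy by metis
    next
      case 3
      have "nearest X s = nearest X t"
        using fold_vertex_far[OF X S True k near 3]
          fold_vertex_far[OF X S(2,1) ts near(2,1) 3(2,1)] by blast
      then show ?thesis using x y by (auto simp: fold_vertex_def split: if_splits)
    qed
  next
    case False
    have "m s t = m x t" using S xy False by (intro label_const_on_odd_class) auto
    moreover have "m t x = m y x"
    proof (rule label_const_on_odd_class)
      show "\<not> odd_label m t x"
        using False S xy odd_label_sym[of s x] odd_label_sym[of t x] odd_label_trans[of s x t] by blast
    qed (use S xy in auto)
    ultimately have "m x y = enat k" using S xy k label_sym by metis
    then show ?thesis by simp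
  qed
qed

section \<open>The retraction induced by folding\<close>

definition fold_gen :: "'a set \<Rightarrow> 'a \<Rightarrow> ('a \<times> bool) list set" where
  "fold_gen X s = (case fold_vertex X s of None \<Rightarrow> \<one>\<^bsub>artin_group S m\<^esub> | Some x \<Rightarrow> artin_gen S m x)"

lemma fold_gen_in_parabolic:
  assumes "X \<subseteq> S"
  shows "fold_gen X s \<in> parabolic S m X"
  using fold_vertex_Some[of X s]
  by (auto simp: fold_gen_def nearest_def subgroup.one_closed[OF parabolic_subgroup[OF assms]]
      intro: artin_gen_in_parabolic split: option.split)

text \<open>If exactly one generator goes to the identity, the odd classes differ and
  \<open>k\<close> is even. Otherwise the images are equal or have a label dividing
  \<open>k\<close>.\<close>

lemma fold_gen_braid:
  assumes X: "X \<subseteq> S" and S: "s \<in> S" "t \<in> S" and k: "m s t = enat k"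
  shows "alt_prod (artin_group S m) (fold_gen X s) (fold_gen X t) k =
    alt_prod (artin_group S m) (fold_gen X t) (fold_gen X s) k"
proof -
  interpret A: group "artin_group S m" by (rule artin_group_group)
  have inS: "x \<in> S" if "fold_vertex X u = Some x" for x u
    using fold_vertex_Some[OF that] X by (auto simp: nearest_def)
  have even: "even k" if "(fold_vertex X s = None) \<noteq> (fold_vertex X t = None)"
    using fold_vertex_None_cong[OF X S] that k by (auto simp: odd_label_def)
  show ?thesis
  proof (cases "fold_vertex X s")
    case None
    then show ?thesis
    proof (cases "fold_vertex X t")
      case (Some y)
      then show ?thesis
        using None even A.alt_prod_one_even artin_gen_closed[OF inS[OF Some]]
        by (simp add: fold_gen_def)
    qed (simp add: fold_gen_def)
  next
    case x: (Some x)
    show ?thesis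
    proof (cases "fold_vertex X t")
      case None
      then show ?thesis
        using x even A.alt_prod_one_even artin_gen_closed[OF inS[OF x]]
        by (simp add: fold_gen_def)
    next
      case y: (Some y)
      from fold_vertex_label[OF X S k x y]
      consider "x = y" | l where "x \<noteq> y" "m x y = enat l" "l dvd k" by blast
      then show ?thesis
      proof cases
        case 2
        note xy = inS[OF x] inS[OF y]
        have "alt_prod (artin_group S m) (artin_gen S m x) (artin_gen S m y) k =
            alt_prod (artin_group S m) (artin_gen S m y) (artin_gen S m x) k"
          by (rule A.alt_prod_swap_dvd[OF artin_gen_closed[OF xy(1)] artin_gen_closed[OF xy(2)]
                artin_gen_braid[where m = m, OF xy 2(1,2)] 2(3)])
        then show ?thesis by (simp add: fold_gen_def x y)
      qed (simp add: fold_gen_def x y)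
    qed
  qed
qed

text \<open>The universal property extends \<open>fold_gen\<close> to an endomorphism. It lands in
  the subgroup because the images of all letters do, and it is the identity there by
  \<open>fold_vertex_id\<close>.\<close>

lemma parabolic_retraction:
  assumes X: "X \<subseteq> S"
  shows "has_retraction (artin_group S m) (parabolic S m X)"
proof -
  let ?A = "artin_group S m" and ?H = "parabolic S m X"
  interpret A: group ?A by (rule artin_group_group)
  have H: "subgroup ?H ?A" using X by (rule parabolic_subgroup)
  have fold_A: "fold_gen X s \<in> carrier ?A" for s
    using fold_gen_in_parabolic[OF X] subgroup.subset[OF H] by blast
  define g where "g l = (if snd l then fold_gen X (fst l) else inv\<^bsub>?A\<^esub> fold_gen X (fst l))" for l :: "'a \<times> bool"
  have g: "g (s, True) = fold_gen X s" "g (s, False) = inv\<^bsub>?A\<^esub> fold_gen X s" for s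
    by (simp_all add: g_def)
  interpret artin_assignment ?A S m g
  proof
    fix s t k assume "s \<in> S" "t \<in> S" "m s t = enat k"
    then show "alt_prod ?A (g (s, True)) (g (t, True)) k = alt_prod ?A (g (t, True)) (g (s, True)) k"
      using fold_gen_braid[OF X] by (simp add: g_def)
  qed (simp_all add: g_def fold_A)
  interpret F: group_hom ?A ?A "artin_lift ?A g"
    by unfold_locales (rule lift_hom)
  have fixed: "artin_lift ?A g h = h" if "h \<in> ?H" for h
    using that unfolding parabolic_def
  proof (induction rule: generate.induct)
    case (incl h)
    then obtain s where s: "s \<in> X" "h = artin_gen S m s" by blast
    with X have "s \<in> S" by blast
    with s show ?case
      using X by (simp add: lift_gen g fold_gen_def fold_vertex_id)
  next
    case (inv h)
    then obtain s where s: "s \<in> X" "h = artin_gen S m s" by blast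
    with X have "s \<in> S" by blast
    with s show ?case
      using X by (simp add: lift_inv_gen g fold_gen_def fold_vertex_id)
  next
    case (eng h1 h2)
    then have "h1 \<in> ?H" "h2 \<in> ?H" by (simp_all add: parabolic_def)
    then have "h1 \<in> carrier ?A" "h2 \<in> carrier ?A" using subgroup.subset[OF H] by blast+
    with eng show ?case by simp
  qed simp
  have image: "artin_lift ?A g x \<in> ?H" if x: "x \<in> carrier ?A" for x
  proof -
    obtain w where w: "w \<in> lists (S \<times> UNIV)" "x = artin_class S m w"
      using x by (auto simp: artin_carrier)
    have "g l \<in> ?H" for l
      using fold_gen_in_parabolic[OF X] subgroup.m_inv_closed[OF H] by (simp add: g_def)
    then have "word_eval ?A g w \<in> ?H"
      by (induction w) (auto simp: subgroup.one_closed[OF H] subgroup.m_closed[OF H])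
    then show ?thesis using w by (simp add: lift_class)
  qed
  have "artin_lift ?A g \<in> hom ?A (?A\<lparr>carrier := ?H\<rparr>)"
    using image by (intro homI) simp_all
  with fixed show ?thesis unfolding has_retraction_def by blast
qed

end

section \<open>Retractability tested on triples\<close>

theorem theorem1p1:
  fixes S :: "'a set" and m :: "'a \<Rightarrow> 'a \<Rightarrow> enat"
  assumes "finite S" and "coxeter_matrix S m"
  shows "parabolic_retractable S m \<longleftrightarrow>
    (\<forall>a\<in>S. \<forall>b\<in>S. \<forall>c\<in>S. a \<noteq> b \<and> a \<noteq> c \<and> b \<noteq> c \<longrightarrow>
       has_retraction ((artin_group S m)\<lparr>carrier := parabolic S m {a, b, c}\<rparr>)
                      (parabolic S m {b, c}))"
    (is "_ \<longleftrightarrow> ?triples")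
proof
  let ?A = "artin_group S m"
  assume retr: "parabolic_retractable S m"
  show ?triples
  proof (intro ballI impI)
    fix a b c assume S: "a \<in> S" "b \<in> S" "c \<in> S"
    \<comment> \<open>A retraction of the whole group restricts to the subgroup generated by the
      triple.\<close>
    then have "has_retraction ?A (parabolic S m {b, c})"
      using retr by (simp add: parabolic_retractable_def)
    then obtain \<phi> where "\<phi> \<in> hom ?A (?A\<lparr>carrier := parabolic S m {b, c}\<rparr>)"
      "\<forall>h\<in>parabolic S m {b, c}. \<phi> h = h"
      by (auto simp: has_retraction_def)
    moreover have "parabolic S m {a, b, c} \<subseteq> carrier ?A"
      using S by (intro subgroup.subset parabolic_subgroup) auto
    ultimately show "has_retraction (?A\<lparr>carrier := parabolic S m {a, b, c}\<rparr>) (parabolic S m {b, c})"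
      unfolding has_retraction_def
      by (intro exI[of _ \<phi>] conjI homI) (simp_all add: hom_def Pi_iff subset_iff)
  qed
next
  assume triples: ?triples
  interpret foldable_matrix S m
  proof
    fix a b c p q
    assume "a \<in> S" "b \<in> S" "c \<in> S" "a \<noteq> b" "a \<noteq> c" "b \<noteq> c"
      and "m a b = enat p" "odd p" "m a c = enat q"
    with triples show "\<exists>r. m b c = enat r \<and> (r dvd p \<or> r dvd q)"
      by (intro triangle_labels[OF assms(2)]) auto
  qed (rule assms(2))
  show "parabolic_retractable S m"
    unfolding parabolic_retractable_def by (simp add: parabolic_retraction)
qed

end
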